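(* Let $k\in\mathbb{N}$, let $\mathsf{D}_1,\mathsf{D}_2$ be finite coherent DP-cores with identity cleaning, let $P_i=\mathcal{P}(\mathsf{D}_i)$, and assume $P_1$ is closed under subgraphs. Then the Premise-Pruned Inclusion Test (described in the context) terminates. Moreover: (Soundness) if an inconsistent $(k,\mathsf{D}_1,\mathsf{D}_2)$-state is reachable from the initial state using the deduction rules, then there exists $\tau\in\mathcal{T}_k$ with $G(\tau)\in P_1$ and $G(\tau)\notin P_2$; (Completeness) if there exists $\tau\in\mathcal{T}_k$ with $G(\tau)\in P_1$ and $G(\tau)\notin P_2$, then an inconsistent state is reachable, and there is such a reachability derivation in which every intermediate state satisfies the premise. Consequently, the algorithm returns "Inclusion Holds" if and only if there is no $\tau\in\mathcal{T}_k$ with $G(\tau)\in P_1$ and $G(\tau)\notin P_2$.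
   Context: Graphs are triples $(V,E,\rho)$, $V,E$ finite subsets of $\mathbb{N}$, $\rho\subseteq E\times V$, each edge incident to exactly two distinct vertices (parallel edges allowed). Graph properties are isomorphism-closed sets of graphs; $P$ is closed under subgraphs if whenever $G\in P$ and $H$ embeds into $G$ (injective vertex and edge maps preserving and reflecting incidence) then $H\in P$. Instructive decompositions: the $k$-instructive alphabet has $\mathtt{Leaf}$ (arity 0), $\mathtt{IntroVertex}_u$, $\mathtt{ForgetVertex}_u$ ($u\in[k+1]$), $\mathtt{IntroEdge}_{u,v}$ (distinct $u,v\in[k+1]$) of arity 1, and $\mathtt{Join}$ of arity 2. $\mathcal{T}_k$ is the set of terms legal w.r.t. bags (Leaf has bag $\emptyset$; IntroVertex$_u$ needs $u\notin$ bag and adds it; ForgetVertex$_u$ needs $u\in$ bag and removes it; IntroEdge$_{u,v}$ needs $u,v\in$ bag; Join needs equal child bags); $B(\tau)$ is the top bag. $G(\tau)$: Leaf gives the empty graph; IntroVertex$_u$ adds a fresh isolated vertex labeled $u$; ForgetVertex$_u$ drops label $u$; IntroEdge$_{u,v}$ adds a new edge between the vertices labeled $u,v$; Join is the disjoint union of child graphs with the vertices carrying the same bag label identified (edges never identified). A graph has treewidth $\le k$ iff isomorphic to some $G(\tau)$, $\tau\in\mathcal{T}_k$. DP-cores: $\mathsf{D}[k]$ consists of witnesses $\mathcal{W}_k\subseteq\{0,1\}^*$ (decidable), $\mathtt{Final}_k:\mathcal{W}_k\to\{0,1\}$, finite $\mathtt{Leaf}_k\subseteq\mathcal{W}_k$,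 transitions $\mathtt{IntroVertex}_u,\mathtt{ForgetVertex}_u,\mathtt{IntroEdge}_{u,v}:\mathcal{W}_k\to$ finite subsets and $\mathtt{Join}:\mathcal{W}_k^2\to$ finite subsets (lifted to finite sets by union), and $\mathtt{Clean}_k$. $\mathrm{Dyn}_k(\tau)$: $\mathtt{Leaf}_k$ at leaves, otherwise $\mathtt{Clean}_k$ of the lifted transition applied to children's dynamizations. $\mathsf{D}[k]$ accepts $\tau$ if $\mathrm{Dyn}_k(\tau)$ contains a final witness. $\mathcal{P}(\mathsf{D})=\bigcup_k$ iso-closure of $\{G(\tau):\tau\in\mathcal{T}_k$ accepted$\}$. Finite: each $\mathcal{W}_k$ finite. Identity cleaning: $\mathtt{Clean}_k=\mathrm{id}$. Coherent: for $\tau\in\mathcal{T}_k,\tau'\in\mathcal{T}_{k'}$ with $G(\tau)\cong G(\tau')$, acceptance by $\mathsf{D}[k]$ and $\mathsf{D}[k']$ agree. Triples: a $(k,\mathsf{D}_1,\mathsf{D}_2)$-state is $(b,S_1,S_2)$ with $b\subseteq[k+1]$ and $S_i$ a finite subset of $\mathsf{D}_i[k].\mathcal{W}$. Initial state: $(\emptyset,\mathsf{D}_1[k].\mathtt{Leaf},\mathsf{D}_2[k].\mathtt{Leaf})$. It satisfies the premise if $S_1$ contains a final witness of $\mathsf{D}_1[k]$; it is inconsistent if it satisfies the premise and $S_2$ contains no final witness of $\mathsf{D}_2[k]$. Deduction rules from $(b,S_1,S_2)$: $(b\cup\{u\},\mathtt{IntroVertex}_u(S_1),\mathtt{IntroVertex}_u(S_2))$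 for $u\notin b$; $(b\setminus\{u\},\mathtt{ForgetVertex}_u(S_1),\mathtt{ForgetVertex}_u(S_2))$ for $u\in b$; $(b,\mathtt{IntroEdge}_{u,v}(S_1),\mathtt{IntroEdge}_{u,v}(S_2))$ for distinct $u,v\in b$; and, for another derived state $(b,S_1',S_2')$ with the same bag, $(b,\mathtt{Join}(S_1,S_1'),\mathtt{Join}(S_2,S_2'))$ (transitions of $\mathsf{D}_i[k]$ applied to the $i$-th component). Premise-Pruned Inclusion Test: initialize an empty list $R$, $Init$ the initial state, a FIFO queue $Y=[Init]$, $Seen=\{Init\}$. While $Y\ne\emptyset$: remove the next triple $t=(b,S_1,S_2)$, append it to $R$; if $t$ is inconsistent return $R$; if $t$ satisfies the premise, generate its introduce-vertex, forget-vertex and introduce-edge successors, and for every $(b,S_1',S_2')\in R$ with the same bag that satisfies the premise, the two join successors $(b,\mathtt{Join}(S_1,S_1'),\mathtt{Join}(S_2,S_2'))$ and $(b,\mathtt{Join}(S_1',S_1),\mathtt{Join}(S_2',S_2))$; each successor not in $Seen$ is added to $Seen$ and appended to $Y$. When $Y$ is empty, return "Inclusion Holds". *)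

theory Defs
  imports Main
begin

section \<open>Graphs\<close>

text \<open>\<open>(e, v) \<in> inc G\<close> means that the edge \<open>e\<close> is incident to the vertex \<open>v\<close>.\<close>

record graph =
  verts :: "nat set"
  edges :: "nat set"
  inc :: "(nat \<times> nat) set"

definition is_graph :: "graph \<Rightarrow> bool" where
  "is_graph G \<longleftrightarrow> finite (verts G) \<and> finite (edges G) \<and> inc G \<subseteq> edges G \<times> verts G \<and>
     (\<forall>e\<in>edges G. card {v. (e, v) \<in> inc G} = 2)"

definition graph_iso :: "graph \<Rightarrow> graph \<Rightarrow> bool" where
  "graph_iso G H \<longleftrightarrow> (\<exists>f g. bij_betw f (verts G) (verts H) \<and> bij_betw g (edges G) (edges H) \<and>
     (\<forall>e\<in>edges G. \<forall>v\<in>verts G. (e, v) \<in> inc G \<longleftrightarrow> (g e, f v) \<in> inc H))"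

definition embeds :: "graph \<Rightarrow> graph \<Rightarrow> bool" where
  "embeds H G \<longleftrightarrow> (\<exists>f g. inj_on f (verts H) \<and> f ` verts H \<subseteq> verts G \<and>
     inj_on g (edges H) \<and> g ` edges H \<subseteq> edges G \<and>
     (\<forall>e\<in>edges H. \<forall>v\<in>verts H. (e, v) \<in> inc H \<longleftrightarrow> (g e, f v) \<in> inc G))"

definition subgraph_closed :: "graph set \<Rightarrow> bool" where
  "subgraph_closed P \<longleftrightarrow> (\<forall>G\<in>P. \<forall>H. is_graph H \<longrightarrow> embeds H G \<longrightarrow> H \<in> P)"


section \<open>Instructive tree decompositions\<close>

datatype iterm =
    Leaf
  | IntroVertex nat iterm
  | ForgetVertex nat iterm
  | IntroEdge nat nat iterm
  | Join iterm iterm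

definition labels :: "nat \<Rightarrow> nat set" where
  "labels k = {1..k + 1}"

fun bag :: "iterm \<Rightarrow> nat set" where
  "bag Leaf = {}"
| "bag (IntroVertex u t) = insert u (bag t)"
| "bag (ForgetVertex u t) = bag t - {u}"
| "bag (IntroEdge u v t) = bag t"
| "bag (Join s t) = bag s"

fun legal :: "nat \<Rightarrow> iterm \<Rightarrow> bool" where
  "legal k Leaf \<longleftrightarrow> True"
| "legal k (IntroVertex u t) \<longleftrightarrow> legal k t \<and> u \<in> labels k \<and> u \<notin> bag t"
| "legal k (ForgetVertex u t) \<longleftrightarrow> legal k t \<and> u \<in> labels k \<and> u \<in> bag t"
| "legal k (IntroEdge u v t) \<longleftrightarrow>
     legal k t \<and> u \<in> labels k \<and> v \<in> labels k \<and> u \<noteq> v \<and> u \<in> bag t \<and> v \<in> bag t"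
| "legal k (Join s t) \<longleftrightarrow> legal k s \<and> legal k t \<and> bag s = bag t"

definition terms :: "nat \<Rightarrow> iterm set" where
  "terms k = {t. legal k t}"

text \<open>
  The labelled graph of a term is a graph with a partial map from labels to vertices, whose domain
  is the bag for legal terms. Fresh names lie above all names in use. In a join, a vertex of
  the right graph carrying a label becomes the vertex of the left graph with that label; the
  other vertices and all edges of the right graph are shifted past those of the left graph.
\<close>

type_synonym lgraph = "graph \<times> (nat \<rightharpoonup> nat)"

definition fresh :: "nat set \<Rightarrow> nat" where
  "fresh A = (if A = {} then 0 else Suc (Max A))"

definition glue_vertex :: "lgraph \<Rightarrow> lgraph \<Rightarrow> nat \<Rightarrow> nat" where
  "glue_vertex L1 L2 y =
     (if y \<in> ran (snd L2) then the (snd L1 (THE u. snd L2 u = Some y))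
      else fresh (verts (fst L1)) + y)"

definition glue_edge :: "lgraph \<Rightarrow> nat \<Rightarrow> nat" where
  "glue_edge L1 e = fresh (edges (fst L1)) + e"

definition glue :: "lgraph \<Rightarrow> lgraph \<Rightarrow> lgraph" where
  "glue L1 L2 =
     (\<lparr>verts = verts (fst L1) \<union> glue_vertex L1 L2 ` verts (fst L2),
       edges = edges (fst L1) \<union> glue_edge L1 ` edges (fst L2),
       inc = inc (fst L1) \<union> map_prod (glue_edge L1) (glue_vertex L1 L2) ` inc (fst L2)\<rparr>,
      snd L1)"

fun lgraph_of :: "iterm \<Rightarrow> lgraph" where
  "lgraph_of Leaf = (\<lparr>verts = {}, edges = {}, inc = {}\<rparr>, Map.empty)"
| "lgraph_of (IntroVertex u t) =
     (let (G, \<theta>) = lgraph_of t; x = fresh (verts G)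
      in (G\<lparr>verts := insert x (verts G)\<rparr>, \<theta>(u \<mapsto> x)))"
| "lgraph_of (ForgetVertex u t) =
     (let (G, \<theta>) = lgraph_of t in (G, \<theta>(u := None)))"
| "lgraph_of (IntroEdge u v t) =
     (let (G, \<theta>) = lgraph_of t; e = fresh (edges G)
      in (G\<lparr>edges := insert e (edges G),
            inc := inc G \<union> {(e, the (\<theta> u)), (e, the (\<theta> v))}\<rparr>, \<theta>))"
| "lgraph_of (Join s t) = glue (lgraph_of s) (lgraph_of t)"

definition graph_of :: "iterm \<Rightarrow> graph" where
  "graph_of t = fst (lgraph_of t)"


section \<open>DP-cores\<close>

type_synonym witness = "bool list"

record core =
  witnesses :: "witness set"
  final :: "witness \<Rightarrow> bool"
  leaf :: "witness set"
  intro_vertex :: "nat \<Rightarrow> witness \<Rightarrow> witness set"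
  forget_vertex :: "nat \<Rightarrow> witness \<Rightarrow> witness set"
  intro_edge :: "nat \<Rightarrow> nat \<Rightarrow> witness \<Rightarrow> witness set"
  join :: "witness \<Rightarrow> witness \<Rightarrow> witness set"
  clean :: "witness set \<Rightarrow> witness set"

type_synonym dp_core = "nat \<Rightarrow> core"

definition fin_subsets :: "'a set \<Rightarrow> 'a set set" where
  "fin_subsets A = {S. finite S \<and> S \<subseteq> A}"

definition wf_core :: "nat \<Rightarrow> core \<Rightarrow> bool" where
  "wf_core k C \<longleftrightarrow>
     leaf C \<in> fin_subsets (witnesses C) \<and>
     (\<forall>u\<in>labels k. \<forall>w\<in>witnesses C. intro_vertex C u w \<in> fin_subsets (witnesses C)) \<and>
     (\<forall>u\<in>labels k. \<forall>w\<in>witnesses C. forget_vertex C u w \<in> fin_subsets (witnesses C)) \<and>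
     (\<forall>u\<in>labels k. \<forall>v\<in>labels k. u \<noteq> v \<longrightarrow>
        (\<forall>w\<in>witnesses C. intro_edge C u v w \<in> fin_subsets (witnesses C))) \<and>
     (\<forall>w\<in>witnesses C. \<forall>w'\<in>witnesses C. join C w w' \<in> fin_subsets (witnesses C)) \<and>
     (\<forall>S\<in>fin_subsets (witnesses C). clean C S \<in> fin_subsets (witnesses C))"

definition is_dp_core :: "dp_core \<Rightarrow> bool" where
  "is_dp_core D \<longleftrightarrow> (\<forall>k. wf_core k (D k))"

definition lift :: "('a \<Rightarrow> 'b set) \<Rightarrow> 'a set \<Rightarrow> 'b set" where
  "lift f S = (\<Union>w\<in>S. f w)"

definition lift2 :: "('a \<Rightarrow> 'b \<Rightarrow> 'c set) \<Rightarrow> 'a set \<Rightarrow> 'b set \<Rightarrow> 'c set" where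
  "lift2 f S S' = (\<Union>w\<in>S. \<Union>w'\<in>S'. f w w')"

fun dyn :: "core \<Rightarrow> iterm \<Rightarrow> witness set" where
  "dyn C Leaf = leaf C"
| "dyn C (IntroVertex u t) = clean C (lift (intro_vertex C u) (dyn C t))"
| "dyn C (ForgetVertex u t) = clean C (lift (forget_vertex C u) (dyn C t))"
| "dyn C (IntroEdge u v t) = clean C (lift (intro_edge C u v) (dyn C t))"
| "dyn C (Join s t) = clean C (lift2 (join C) (dyn C s) (dyn C t))"

definition has_final :: "core \<Rightarrow> witness set \<Rightarrow> bool" where
  "has_final C S \<longleftrightarrow> (\<exists>w\<in>S. final C w)"

definition accepts :: "core \<Rightarrow> iterm \<Rightarrow> bool" where
  "accepts C t \<longleftrightarrow> has_final C (dyn C t)"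

definition graph_property :: "dp_core \<Rightarrow> graph set" where
  "graph_property D =
     (\<Union>k. {H. is_graph H \<and> (\<exists>t\<in>terms k. accepts (D k) t \<and> graph_iso (graph_of t) H)})"

definition finite_core :: "dp_core \<Rightarrow> bool" where
  "finite_core D \<longleftrightarrow> (\<forall>k. finite (witnesses (D k)))"

definition identity_cleaning :: "dp_core \<Rightarrow> bool" where
  "identity_cleaning D \<longleftrightarrow> (\<forall>k. \<forall>S\<in>fin_subsets (witnesses (D k)). clean (D k) S = S)"

definition coherent :: "dp_core \<Rightarrow> bool" where
  "coherent D \<longleftrightarrow> (\<forall>k k'. \<forall>t\<in>terms k. \<forall>t'\<in>terms k'.
     graph_iso (graph_of t) (graph_of t') \<longrightarrow> (accepts (D k) t \<longleftrightarrow> accepts (D k') t'))"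


section \<open>States and deduction\<close>

type_synonym state = "nat set \<times> witness set \<times> witness set"

definition states :: "nat \<Rightarrow> dp_core \<Rightarrow> dp_core \<Rightarrow> state set" where
  "states k D1 D2 =
     Pow (labels k) \<times> fin_subsets (witnesses (D1 k)) \<times> fin_subsets (witnesses (D2 k))"

definition init_state :: "nat \<Rightarrow> dp_core \<Rightarrow> dp_core \<Rightarrow> state" where
  "init_state k D1 D2 = ({}, leaf (D1 k), leaf (D2 k))"

fun premise :: "nat \<Rightarrow> dp_core \<Rightarrow> state \<Rightarrow> bool" where
  "premise k D1 (b, S1, S2) \<longleftrightarrow> has_final (D1 k) S1"

fun inconsistent :: "nat \<Rightarrow> dp_core \<Rightarrow> dp_core \<Rightarrow> state \<Rightarrow> bool" where
  "inconsistent k D1 D2 (b, S1, S2) \<longleftrightarrow> premise k D1 (b, S1, S2) \<and> \<not> has_final (D2 k) S2"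

fun unary_succs :: "nat \<Rightarrow> dp_core \<Rightarrow> dp_core \<Rightarrow> state \<Rightarrow> state set" where
  "unary_succs k D1 D2 (b, S1, S2) =
     {(b \<union> {u}, lift (intro_vertex (D1 k) u) S1, lift (intro_vertex (D2 k) u) S2) | u.
        u \<in> labels k \<and> u \<notin> b} \<union>
     {(b - {u}, lift (forget_vertex (D1 k) u) S1, lift (forget_vertex (D2 k) u) S2) | u.
        u \<in> b} \<union>
     {(b, lift (intro_edge (D1 k) u v) S1, lift (intro_edge (D2 k) u v) S2) | u v.
        u \<in> b \<and> v \<in> b \<and> u \<noteq> v}"

text \<open>Used only for states with the same bag.\<close>

fun join_succ :: "nat \<Rightarrow> dp_core \<Rightarrow> dp_core \<Rightarrow> state \<Rightarrow> state \<Rightarrow> state" where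
  "join_succ k D1 D2 (b, S1, S2) (b', S1', S2') =
     (b, lift2 (join (D1 k)) S1 S1', lift2 (join (D2 k)) S2 S2')"

text \<open>
  A derivation lists states, each of which is initial or follows by one deduction rule from
  strictly earlier entries.
\<close>

definition derivation :: "nat \<Rightarrow> dp_core \<Rightarrow> dp_core \<Rightarrow> state list \<Rightarrow> bool" where
  "derivation k D1 D2 ss \<longleftrightarrow> (\<forall>i<length ss.
     ss ! i = init_state k D1 D2 \<or>
     (\<exists>j<i. ss ! i \<in> unary_succs k D1 D2 (ss ! j)) \<or>
     (\<exists>j<i. \<exists>l<i. fst (ss ! j) = fst (ss ! l) \<and> ss ! i = join_succ k D1 D2 (ss ! j) (ss ! l)))"

definition derives :: "nat \<Rightarrow> dp_core \<Rightarrow> dp_core \<Rightarrow> state list \<Rightarrow> state \<Rightarrow> bool" where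
  "derives k D1 D2 ss s \<longleftrightarrow> derivation k D1 D2 ss \<and> ss \<noteq> [] \<and> last ss = s"

definition reachable :: "nat \<Rightarrow> dp_core \<Rightarrow> dp_core \<Rightarrow> state \<Rightarrow> bool" where
  "reachable k D1 D2 s \<longleftrightarrow> (\<exists>ss. derives k D1 D2 ss s)"


section \<open>The premise-pruned inclusion test\<close>

text \<open>
  The test is a transition system with one step per loop iteration. The order in which the
  successors of a state are generated is left open, so a step may use any enumeration
  \<open>ss\<close> of them; this is the only source of nondeterminism.
\<close>

datatype outcome = Found "state list" | Inclusion_Holds

datatype config = Running "state list" "state list" "state set" | Returned outcome

definition enqueue :: "state \<Rightarrow> state list \<times> state set \<Rightarrow> state list \<times> state set" where
  "enqueue s = (\<lambda>(Y, Seen). if s \<in> Seen then (Y, Seen) else (Y @ [s], insert s Seen))"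

definition successors ::
    "nat \<Rightarrow> dp_core \<Rightarrow> dp_core \<Rightarrow> state list \<Rightarrow> state \<Rightarrow> state set" where
  "successors k D1 D2 R t = unary_succs k D1 D2 t \<union>
     (\<Union>s\<in>{s \<in> set R. fst s = fst t \<and> premise k D1 s}.
        {join_succ k D1 D2 t s, join_succ k D1 D2 s t})"

inductive step :: "nat \<Rightarrow> dp_core \<Rightarrow> dp_core \<Rightarrow> config \<Rightarrow> config \<Rightarrow> bool"
  for k D1 D2 where
  step_empty:
    "step k D1 D2 (Running R [] Seen) (Returned Inclusion_Holds)"
| step_inconsistent:
    "inconsistent k D1 D2 t \<Longrightarrow>
     step k D1 D2 (Running R (t # Y) Seen) (Returned (Found (R @ [t])))"
| step_prune:
    "\<not> inconsistent k D1 D2 t \<Longrightarrow> \<not> premise k D1 t \<Longrightarrow>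
     step k D1 D2 (Running R (t # Y) Seen) (Running (R @ [t]) Y Seen)"
| step_expand:
    "\<not> inconsistent k D1 D2 t \<Longrightarrow> premise k D1 t \<Longrightarrow>
     set ss = successors k D1 D2 (R @ [t]) t \<Longrightarrow>
     fold enqueue ss (Y, Seen) = (Y', Seen') \<Longrightarrow>
     step k D1 D2 (Running R (t # Y) Seen) (Running (R @ [t]) Y' Seen')"

definition init_config :: "nat \<Rightarrow> dp_core \<Rightarrow> dp_core \<Rightarrow> config" where
  "init_config k D1 D2 = Running [] [init_state k D1 D2] {init_state k D1 D2}"

definition test_reaches :: "nat \<Rightarrow> dp_core \<Rightarrow> dp_core \<Rightarrow> config \<Rightarrow> bool" where
  "test_reaches k D1 D2 c \<longleftrightarrow> (step k D1 D2)\<^sup>*\<^sup>* (init_config k D1 D2) c"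

definition test_returns :: "nat \<Rightarrow> dp_core \<Rightarrow> dp_core \<Rightarrow> outcome \<Rightarrow> bool" where
  "test_returns k D1 D2 r \<longleftrightarrow> test_reaches k D1 D2 (Returned r)"

text \<open>No run is infinite, and a run can only stop by returning an outcome.\<close>

definition test_terminates :: "nat \<Rightarrow> dp_core \<Rightarrow> dp_core \<Rightarrow> bool" where
  "test_terminates k D1 D2 \<longleftrightarrow>
     (\<nexists>c. c 0 = init_config k D1 D2 \<and> (\<forall>i::nat. step k D1 D2 (c i) (c (Suc i)))) \<and>
     (\<forall>c. test_reaches k D1 D2 c \<longrightarrow> (\<nexists>c'. step k D1 D2 c c') \<longrightarrow> (\<exists>r. c = Returned r))"

end

theory Submission
  imports Defs
begin

text \<open>
  For legal terms, the state \<open>(bag t, dyn (D1 k) t, dyn (D2 k) t)\<close> records everything the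
  deduction rules see, and the derivable states are exactly those of legal terms. By coherence,
  acceptance of \<open>t\<close> is membership of its graph in the property, so inconsistent states are exactly
  the states of counterexamples. The graph of a subterm embeds into the graph of the whole term;
  hence, if \<open>P1\<close> is closed under subgraphs, every subterm of a counterexample satisfies the premise
  and pruning loses nothing. Termination holds because there are only finitely many states and each
  of them is queued at most once.
\<close>

section \<open>Graphs of terms\<close>

lemma less_fresh: "finite A \<Longrightarrow> x \<in> A \<Longrightarrow> x < fresh A"
  by (auto simp: fresh_def less_Suc_eq_le)

lemma fresh_notin: "finite A \<Longrightarrow> fresh A + n \<notin> A"
  using less_fresh[of A "fresh A + n"] by auto

text \<open>What a join needs from its children. Injectivity of the label map makes the
  \<open>THE\<close> in \<open>glue_vertex\<close> unambiguous and keeps distinct vertices of one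
  child from being merged.\<close>

definition well_labelled :: "lgraph \<Rightarrow> bool" where
  "well_labelled L \<longleftrightarrow>
     is_graph (fst L) \<and> ran (snd L) \<subseteq> verts (fst L) \<and> inj_on (snd L) (dom (snd L))"

lemma embeds_subset:
  assumes "verts H \<subseteq> verts G" and "edges H \<subseteq> edges G"
    and "\<And>e v. e \<in> edges H \<Longrightarrow> v \<in> verts H \<Longrightarrow> (e, v) \<in> inc H \<longleftrightarrow> (e, v) \<in> inc G"
  shows "embeds H G"
  unfolding embeds_def
  by (rule exI[of _ id], rule exI[of _ id]) (use assms in auto)

lemma graph_iso_refl: "graph_iso G G"
  unfolding graph_iso_def by (rule exI[of _ id], rule exI[of _ id]) auto

section \<open>Gluing two labelled graphs along common labels\<close>

locale gluing =
  fixes L1 L2 :: lgraph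
  assumes well_labelled1: "well_labelled L1"
    and well_labelled2: "well_labelled L2"
    and same_labels: "dom (snd L1) = dom (snd L2)"
begin

abbreviation "gv \<equiv> glue_vertex L1 L2"
abbreviation "ge \<equiv> glue_edge L1"

lemma graphs: "is_graph (fst L1)" "is_graph (fst L2)"
  using well_labelled1 well_labelled2 by (auto simp: well_labelled_def)

text \<open>The label map of \<open>L2\<close> is injective, so a vertex determines its label and
  the description in \<open>glue_vertex\<close> has a unique solution.\<close>

lemma glue_vertex_label:
  assumes "snd L2 u = Some y"
  shows "gv y = the (snd L1 u)"
proof -
  have "(THE u'. snd L2 u' = Some y) = u"
  proof (rule the_equality)
    fix u' assume "snd L2 u' = Some y"
    then show "u' = u"
      using assms well_labelled2 by (auto simp: well_labelled_def inj_on_def dom_def)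
  qed fact
  moreover have "y \<in> ran (snd L2)"
    using assms by (auto simp: ran_def)
  ultimately show ?thesis
    by (simp add: glue_vertex_def)
qed

text \<open>Labelled vertices land inside the left graph, all others outside it, because the shift
  exceeds every vertex of the left graph. This dichotomy drives the injectivity proof.\<close>

lemma glue_vertex_cases:
  obtains (label) u where "snd L2 u = Some y" "snd L1 u = Some (gv y)" "gv y \<in> verts (fst L1)"
  | (new) "y \<notin> ran (snd L2)" "gv y = fresh (verts (fst L1)) + y" "gv y \<notin> verts (fst L1)"
proof (cases "y \<in> ran (snd L2)")
  case True
  then obtain u where u: "snd L2 u = Some y"
    by (auto simp: ran_def)
  then obtain x where x: "snd L1 u = Some x"
    using same_labels by (metis domD domI)
  then have "x \<in> verts (fst L1)"
    using well_labelled1 by (auto simp: well_labelled_def ran_def)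
  then show ?thesis
    using label u x glue_vertex_label[OF u] by simp
next
  case False
  then show ?thesis
    using new graphs(1) fresh_notin by (simp add: glue_vertex_def is_graph_def)
qed

text \<open>Images of different kinds lie on different sides of \<open>verts (fst L1)\<close>. Two
  labelled vertices with one image have one label, since the label map of \<open>L1\<close> is
  injective; two unlabelled vertices are moved by the same shift.\<close>

lemma inj_glue_vertex: "inj gv"
proof (rule injI)
  fix x y assume eq: "gv x = gv y"
  show "x = y"
  proof (cases x rule: glue_vertex_cases)
    case (label u)
    note x = label
    show ?thesis
    proof (cases y rule: glue_vertex_cases)
      case (label v)
      have "u = v"
        using x(2) label(2) eq well_labelled1
        by (auto simp: well_labelled_def inj_on_def dom_def)
      then show ?thesis
        using x(1) label(1) by simp
    next
      case new
      then show ?thesis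
        using x(3) eq by metis
    qed
  next
    case new
    note x = new
    show ?thesis
    proof (cases y rule: glue_vertex_cases)
      case (label v)
      then show ?thesis
        using x(3) eq by metis
    next
      case new
      then show ?thesis
        using x(2) eq by linarith
    qed
  qed
qed

lemma inj_glue_edge: "inj ge"
  by (auto simp: inj_def glue_edge_def)

lemma glue_edge_notin: "ge e \<notin> edges (fst L1)"
  using graphs(1) fresh_notin by (simp add: glue_edge_def is_graph_def)

lemma inc_glue_left:
  assumes "e \<in> edges (fst L1)"
  shows "(e, v) \<in> inc (fst (glue L1 L2)) \<longleftrightarrow> (e, v) \<in> inc (fst L1)"
  using assms glue_edge_notin by (auto simp: glue_def)

text \<open>Shifted edges never coincide with left edges, so all their incidences are copied from
  the right graph.\<close>

lemma inc_glue_right: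
  "(ge e, v) \<in> inc (fst (glue L1 L2)) \<longleftrightarrow> (\<exists>y. v = gv y \<and> (e, y) \<in> inc (fst L2))"
proof -
  have "(ge e, v) \<notin> inc (fst L1)"
    using graphs(1) glue_edge_notin by (auto simp: is_graph_def)
  then show ?thesis
    by (auto simp: glue_def dest: injD[OF inj_glue_edge])
qed

lemma is_graph_glue: "is_graph (fst (glue L1 L2))"
proof -
  let ?G = "fst (glue L1 L2)"
  have "card {v. (e, v) \<in> inc ?G} = 2" if e: "e \<in> edges ?G" for e
  proof (cases "e \<in> edges (fst L1)")
    case True
    then show ?thesis
      using graphs(1) by (simp add: inc_glue_left is_graph_def)
  next
    case False
    then obtain e' where e': "e = ge e'" "e' \<in> edges (fst L2)"
      using e by (auto simp: glue_def)
    \<comment> \<open>Injectivity of \<open>gv\<close> keeps the two endpoints of a right edge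
      distinct after the gluing.\<close>
    have "{v. (e, v) \<in> inc ?G} = gv ` {v. (e', v) \<in> inc (fst L2)}"
      by (auto simp: e' inc_glue_right)
    then show ?thesis
      using graphs(2) e'(2) inj_glue_vertex
      by (simp add: is_graph_def card_image inj_on_subset)
  qed
  moreover have "inc ?G \<subseteq> edges ?G \<times> verts ?G" "finite (verts ?G)" "finite (edges ?G)"
    using graphs by (auto simp: is_graph_def glue_def)
  ultimately show ?thesis
    by (simp add: is_graph_def)
qed

lemma well_labelled_glue: "well_labelled (glue L1 L2)"
  using is_graph_glue well_labelled1 by (auto simp: well_labelled_def glue_def)

lemma embeds_glue_left: "embeds (fst L1) (fst (glue L1 L2))"
  by (rule embeds_subset) (simp_all add: inc_glue_left, auto simp: glue_def)

text \<open>The gluing maps themselves form the embedding. Incidence is also reflected: edges are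
  never identified, so merging vertices gives a right edge no further endpoint.\<close>

lemma embeds_glue_right: "embeds (fst L2) (fst (glue L1 L2))"
  unfolding embeds_def
proof (intro exI conjI)
  show "inj_on gv (verts (fst L2))" "inj_on ge (edges (fst L2))"
    using inj_glue_vertex inj_glue_edge by (auto intro: inj_on_subset)
  show "gv ` verts (fst L2) \<subseteq> verts (fst (glue L1 L2))"
    "ge ` edges (fst L2) \<subseteq> edges (fst (glue L1 L2))"
    by (auto simp: glue_def)
  show "\<forall>e\<in>edges (fst L2). \<forall>v\<in>verts (fst L2).
      (e, v) \<in> inc (fst L2) \<longleftrightarrow> (ge e, gv v) \<in> inc (fst (glue L1 L2))"
    by (auto simp: inc_glue_right dest: injD[OF inj_glue_vertex])
qed

end

section \<open>Legal terms yield well-labelled graphs, and subterms yield subgraphs\<close>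

text \<open>The domain of the label map is carried through the induction: it makes
  \<open>the\<close> defined for a new edge, and with equal bags it supplies
  \<open>same_labels\<close> for a join.\<close>

lemma well_labelled_lgraph_of:
  "legal k t \<Longrightarrow> well_labelled (lgraph_of t) \<and> dom (snd (lgraph_of t)) = bag t"
proof (induction t)
  case Leaf
  then show ?case
    by (simp add: well_labelled_def is_graph_def)
next
  case (IntroVertex u t)
  obtain G \<theta> where L: "lgraph_of t = (G, \<theta>)"
    by (cases "lgraph_of t")
  have G: "is_graph G" and ran: "ran \<theta> \<subseteq> verts G" and inj: "inj_on \<theta> (dom \<theta>)"
    and dom: "dom \<theta> = bag t"
    using IntroVertex L by (auto simp: well_labelled_def)
  have u: "\<theta> u = None"
    using dom IntroVertex.prems by auto
  have "fresh (verts G) \<notin> ran \<theta>"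
    using fresh_notin[of "verts G" 0] G ran by (auto simp: is_graph_def)
  then have "Some (fresh (verts G)) \<notin> \<theta> ` dom \<theta>"
    by (auto simp: ran_def)
  then have "inj_on (\<theta>(u \<mapsto> fresh (verts G))) (insert u (dom \<theta>))"
    using inj_on_fun_updI[OF inj] u by auto
  moreover have "ran (\<theta>(u \<mapsto> fresh (verts G))) \<subseteq> insert (fresh (verts G)) (verts G)"
    using ran u by auto
  ultimately show ?case
    using G by (auto simp: L Let_def well_labelled_def is_graph_def simp flip: dom)
next
  case (ForgetVertex u t)
  obtain G \<theta> where L: "lgraph_of t = (G, \<theta>)"
    by (cases "lgraph_of t")
  have "ran (\<theta>(u := None)) \<subseteq> ran \<theta>"
    by (auto simp: ran_def)
  moreover have "inj_on (\<theta>(u := None)) (dom (\<theta>(u := None)))" if "inj_on \<theta> (dom \<theta>)"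
    using that by (auto simp: inj_on_def dom_def split: if_splits)
  ultimately show ?case
    using ForgetVertex L by (auto simp: well_labelled_def simp del: fun_upd_apply)
next
  case (IntroEdge u v t)
  obtain G \<theta> where L: "lgraph_of t = (G, \<theta>)"
    by (cases "lgraph_of t")
  let ?e = "fresh (edges G)"
  have G: "is_graph G" and ran: "ran \<theta> \<subseteq> verts G" and inj: "inj_on \<theta> (dom \<theta>)"
    and dom: "dom \<theta> = bag t"
    using IntroEdge L by (auto simp: well_labelled_def)
  obtain x y where xy: "\<theta> u = Some x" "\<theta> v = Some y"
    using IntroEdge.prems dom by (metis domD legal.simps(4))
  \<comment> \<open>Distinct labels mark distinct vertices, so the new edge has exactly two
    endpoints.\<close>
  have "x \<noteq> y"
    using xy inj IntroEdge.prems by (auto simp: inj_on_def dom_def)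
  have xyG: "x \<in> verts G" "y \<in> verts G"
    using ran xy by (auto simp: ran_def)
  have e: "?e \<notin> edges G"
    using fresh_notin[of "edges G" 0] G by (auto simp: is_graph_def)
  let ?G = "fst (lgraph_of (IntroEdge u v t))"
  have G': "verts ?G = verts G" "edges ?G = insert ?e (edges G)"
    "inc ?G = inc G \<union> {(?e, x), (?e, y)}"
    by (simp_all add: L xy Let_def)
  have "{w. (?e, w) \<in> inc ?G} = {x, y}"
    using e G unfolding G' by (auto simp: is_graph_def)
  moreover have "{w. (e', w) \<in> inc ?G} = {w. (e', w) \<in> inc G}" if "e' \<in> edges G" for e'
    using that e unfolding G' by auto
  ultimately have "\<forall>e'\<in>edges ?G. card {w. (e', w) \<in> inc ?G} = 2"
    using G \<open>x \<noteq> y\<close> unfolding G'(2) by (simp add: is_graph_def)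
  then have "is_graph ?G"
    using G xyG unfolding is_graph_def by (auto simp del: lgraph_of.simps simp: G')
  then show ?case
    using ran inj dom by (simp add: well_labelled_def L Let_def)
next
  case (Join s t)
  then interpret gluing "lgraph_of s" "lgraph_of t"
    by unfold_locales auto
  have "snd (glue (lgraph_of s) (lgraph_of t)) = snd (lgraph_of s)"
    by (simp add: glue_def)
  then show ?case
    using Join well_labelled_glue by auto
qed

lemma is_graph_graph_of: "legal k t \<Longrightarrow> is_graph (graph_of t)"
  using well_labelled_lgraph_of by (auto simp: graph_of_def well_labelled_def)

lemma embeds_IntroVertex: "embeds (graph_of t) (graph_of (IntroVertex u t))"
  by (rule embeds_subset) (auto simp: graph_of_def Let_def split: prod.splits)

lemma embeds_ForgetVertex: "embeds (graph_of t) (graph_of (ForgetVertex u t))"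
  by (rule embeds_subset) (auto simp: graph_of_def Let_def split: prod.splits)

text \<open>Legality makes the edge set finite, hence the new edge really is new and no old edge
  gains an incidence.\<close>

lemma embeds_IntroEdge:
  assumes "legal k (IntroEdge u v t)"
  shows "embeds (graph_of t) (graph_of (IntroEdge u v t))"
proof -
  have "fresh (edges (graph_of t)) \<notin> edges (graph_of t)"
    using fresh_notin[of "edges (graph_of t)" 0] is_graph_graph_of[of k t] assms
    by (auto simp: is_graph_def)
  then show ?thesis
    by (intro embeds_subset) (auto simp: graph_of_def Let_def split: prod.splits)
qed

lemma embeds_Join:
  assumes "legal k (Join s t)"
  shows "embeds (graph_of s) (graph_of (Join s t))" "embeds (graph_of t) (graph_of (Join s t))"
proof -
  interpret gluing "lgraph_of s" "lgraph_of t"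
    using assms well_labelled_lgraph_of[of k s] well_labelled_lgraph_of[of k t]
    by unfold_locales auto
  show "embeds (graph_of s) (graph_of (Join s t))" "embeds (graph_of t) (graph_of (Join s t))"
    using embeds_glue_left embeds_glue_right by (simp_all add: graph_of_def)
qed

lemma bag_subset_labels: "legal k t \<Longrightarrow> bag t \<subseteq> labels k"
  by (induction t) auto

section \<open>Dynamization\<close>

lemma lift_fin_subsets:
  "S \<in> fin_subsets A \<Longrightarrow> (\<And>w. w \<in> A \<Longrightarrow> f w \<in> fin_subsets B) \<Longrightarrow> lift f S \<in> fin_subsets B"
  unfolding fin_subsets_def lift_def by blast

lemma lift2_fin_subsets:
  "S \<in> fin_subsets A \<Longrightarrow> S' \<in> fin_subsets A' \<Longrightarrow>
   (\<And>w w'. w \<in> A \<Longrightarrow> w' \<in> A' \<Longrightarrow> f w w' \<in> fin_subsets B) \<Longrightarrow> lift2 f S S' \<in> fin_subsets B"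
  unfolding fin_subsets_def lift2_def by blast

locale identity_core =
  fixes k :: nat and C :: core
  assumes wf: "wf_core k C"
    and clean_id: "\<And>S. S \<in> fin_subsets (witnesses C) \<Longrightarrow> clean C S = S"
begin

lemma lift_closed:
  assumes "S \<in> fin_subsets (witnesses C)"
  shows "u \<in> labels k \<Longrightarrow> lift (intro_vertex C u) S \<in> fin_subsets (witnesses C)"
    and "u \<in> labels k \<Longrightarrow> lift (forget_vertex C u) S \<in> fin_subsets (witnesses C)"
    and "u \<in> labels k \<Longrightarrow> v \<in> labels k \<Longrightarrow> u \<noteq> v \<Longrightarrow>
      lift (intro_edge C u v) S \<in> fin_subsets (witnesses C)"
    and "S' \<in> fin_subsets (witnesses C) \<Longrightarrow> lift2 (join C) S S' \<in> fin_subsets (witnesses C)"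
  using assms wf
  by (auto simp: wf_core_def intro!: lift_fin_subsets[OF assms] lift2_fin_subsets[OF assms])

lemma dyn_fin_subsets: "legal k t \<Longrightarrow> dyn C t \<in> fin_subsets (witnesses C)"
  by (induction t) (use wf in \<open>auto simp: clean_id lift_closed wf_core_def\<close>)

text \<open>Cleaning is the identity on finite sets of witnesses only. Legality keeps all labels in
  \<open>labels k\<close>, where the transitions are known to produce such sets.\<close>

lemma dyn_legal:
  "legal k (IntroVertex u t) \<Longrightarrow> dyn C (IntroVertex u t) = lift (intro_vertex C u) (dyn C t)"
  "legal k (ForgetVertex u t) \<Longrightarrow> dyn C (ForgetVertex u t) = lift (forget_vertex C u) (dyn C t)"
  "legal k (IntroEdge u v t) \<Longrightarrow> dyn C (IntroEdge u v t) = lift (intro_edge C u v) (dyn C t)"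
  "legal k (Join s t) \<Longrightarrow> dyn C (Join s t) = lift2 (join C) (dyn C s) (dyn C t)"
  by (simp_all add: clean_id lift_closed dyn_fin_subsets)

end

lemma identity_core_at:
  "is_dp_core D \<Longrightarrow> identity_cleaning D \<Longrightarrow> identity_core k (D k)"
  by unfold_locales (auto simp: is_dp_core_def identity_cleaning_def)

text \<open>Membership only provides an accepted term of some width with an isomorphic graph;
  coherence transfers its acceptance to \<open>t\<close>. Conversely \<open>t\<close> is its own
  representative.\<close>

lemma graph_property_iff_accepts:
  assumes "coherent D" and "legal k t"
  shows "graph_of t \<in> graph_property D \<longleftrightarrow> accepts (D k) t"
proof
  assume "graph_of t \<in> graph_property D"
  then show "accepts (D k) t"
    using assms by (auto simp: graph_property_def coherent_def terms_def)
next
  assume "accepts (D k) t"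
  then show "graph_of t \<in> graph_property D"
    using assms is_graph_graph_of graph_iso_refl unfolding graph_property_def terms_def by blast
qed

section \<open>Derivable states are states of terms\<close>

definition state_of :: "nat \<Rightarrow> dp_core \<Rightarrow> dp_core \<Rightarrow> iterm \<Rightarrow> state" where
  "state_of k D1 D2 t = (bag t, dyn (D1 k) t, dyn (D2 k) t)"

lemma premise_state_of: "premise k D1 (state_of k D1 D2 t) \<longleftrightarrow> accepts (D1 k) t"
  by (simp add: state_of_def accepts_def)

lemma inconsistent_state_of:
  "inconsistent k D1 D2 (state_of k D1 D2 t) \<longleftrightarrow> accepts (D1 k) t \<and> \<not> accepts (D2 k) t"
  by (simp add: state_of_def accepts_def)

lemma fst_state_of: "fst (state_of k D1 D2 t) = bag t"
  by (simp add: state_of_def)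

section \<open>Derivations as lists extended at the end\<close>

text \<open>A single rule application with premises drawn from a set. Replacing list positions by a
  set gives monotonicity and allows induction from the end of a derivation.\<close>

definition deducible :: "nat \<Rightarrow> dp_core \<Rightarrow> dp_core \<Rightarrow> state set \<Rightarrow> state \<Rightarrow> bool" where
  "deducible k D1 D2 S s \<longleftrightarrow> s = init_state k D1 D2 \<or> (\<exists>r\<in>S. s \<in> unary_succs k D1 D2 r) \<or>
     (\<exists>r\<in>S. \<exists>r'\<in>S. fst r = fst r' \<and> s = join_succ k D1 D2 r r')"

lemma deducible_mono: "deducible k D1 D2 S s \<Longrightarrow> S \<subseteq> S' \<Longrightarrow> deducible k D1 D2 S' s"
  unfolding deducible_def by blast

lemma derivation_iff_deducible:
  "derivation k D1 D2 ss \<longleftrightarrow> (\<forall>i<length ss. deducible k D1 D2 (set (take i ss)) (ss ! i))"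
proof -
  have "set (take i ss) = (!) ss ` {..<i}" if "i < length ss" for i
    using nth_image[of i ss] that by (simp add: lessThan_atLeast0)
  then show ?thesis
    by (simp add: derivation_def deducible_def Bex_def)
qed

lemma derivation_snoc_iff:
  "derivation k D1 D2 (ss @ [s]) \<longleftrightarrow> derivation k D1 D2 ss \<and> deducible k D1 D2 (set ss) s"
  by (auto simp: derivation_iff_deducible nth_append less_Suc_eq)

lemma derivation_append:
  assumes "derivation k D1 D2 ss" and "derivation k D1 D2 ss'"
  shows "derivation k D1 D2 (ss @ ss')"
  using assms(2)
proof (induction ss' rule: rev_induct)
  case (snoc s ss')
  then have "derivation k D1 D2 ((ss @ ss') @ [s])"
    by (simp only: derivation_snoc_iff) (auto intro: deducible_mono)
  then show ?case
    by simp
qed (use assms(1) in simp)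

text \<open>Every entry used as a premise of a rule lies in \<open>butlast ss\<close>, hence in
  \<open>Q\<close>, so \<open>P\<close> has to be closed only under deductions from
  \<open>P \<inter> Q\<close>. With \<open>Q = UNIV\<close> this is the usual invariant principle;
  with the premise-satisfying states as \<open>Q\<close> it describes pruned search, where the last
  state is unrestricted.\<close>

lemma derivation_subset:
  assumes "derivation k D1 D2 ss" and "set (butlast ss) \<subseteq> Q"
    and "\<And>s. deducible k D1 D2 (P \<inter> Q) s \<Longrightarrow> s \<in> P"
  shows "set ss \<subseteq> P"
  using assms(1,2)
proof (induction ss rule: rev_induct)
  case (snoc s ss)
  have "set ss \<subseteq> P"
    using snoc by (auto simp: derivation_snoc_iff dest: in_set_butlastD)
  moreover have "deducible k D1 D2 (set ss) s" and "set ss \<subseteq> Q"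
    using snoc.prems by (simp_all add: derivation_snoc_iff)
  ultimately have "s \<in> P"
    using assms(3) deducible_mono by (metis le_inf_iff)
  then show ?case
    using \<open>set ss \<subseteq> P\<close> by simp
qed simp

locale core_pair =
  fixes k :: nat and D1 D2 :: dp_core
  assumes core1: "is_dp_core D1" "finite_core D1" "identity_cleaning D1"
    and core2: "is_dp_core D2" "finite_core D2" "identity_cleaning D2"
begin

sublocale C1: identity_core k "D1 k"
  using core1 by (intro identity_core_at)

sublocale C2: identity_core k "D2 k"
  using core2 by (intro identity_core_at)

abbreviation "st \<equiv> state_of k D1 D2"
abbreviation "init \<equiv> init_state k D1 D2"
abbreviation "unary \<equiv> unary_succs k D1 D2"
abbreviation "joins \<equiv> join_succ k D1 D2"

lemma finite_states: "finite (states k D1 D2)"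
proof -
  have "fin_subsets (witnesses (D1 k)) \<subseteq> Pow (witnesses (D1 k))"
    "fin_subsets (witnesses (D2 k)) \<subseteq> Pow (witnesses (D2 k))"
    by (auto simp: fin_subsets_def)
  then show ?thesis
    using core1(2) core2(2) unfolding states_def finite_core_def labels_def
    by (meson finite_Pow_iff finite_SigmaI finite_atLeastAtMost finite_subset)
qed

lemma state_of_in_states: "legal k t \<Longrightarrow> st t \<in> states k D1 D2"
  using bag_subset_labels[of k t]
  by (auto simp: states_def state_of_def C1.dyn_fin_subsets C2.dyn_fin_subsets)

lemma state_of_Leaf: "st Leaf = init"
  by (simp add: state_of_def init_state_def)

lemma unary_state_of:
  "legal k (IntroVertex u t) \<Longrightarrow> st (IntroVertex u t) \<in> unary (st t)"
  "legal k (ForgetVertex u t) \<Longrightarrow> st (ForgetVertex u t) \<in> unary (st t)"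
  "legal k (IntroEdge u v t) \<Longrightarrow> st (IntroEdge u v t) \<in> unary (st t)"
  by (auto simp del: dyn.simps simp: state_of_def C1.dyn_legal C2.dyn_legal)

lemma join_state_of: "legal k (Join s t) \<Longrightarrow> st (Join s t) = joins (st s) (st t)"
  by (simp del: dyn.simps add: state_of_def C1.dyn_legal C2.dyn_legal)

abbreviation "term_states \<equiv> st ` {t. legal k t}"

lemma init_term_state: "init \<in> term_states"
  by (rule image_eqI[of _ _ Leaf]) (simp_all add: state_of_Leaf)

lemma unary_term_state:
  assumes "r \<in> term_states" and "s \<in> unary r"
  shows "s \<in> term_states"
proof -
  obtain t where t: "legal k t" "r = st t"
    using assms(1) by auto
  \<comment> \<open>The forget and edge rules only ask for labels in the bag; that these lie in
    \<open>labels k\<close>, as legality demands, comes from here.\<close>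
  note lab = bag_subset_labels[OF t(1)]
  from assms(2)[unfolded t(2) state_of_def] consider
      u where "u \<in> labels k" "u \<notin> bag t" "s = (bag t \<union> {u},
        lift (intro_vertex (D1 k) u) (dyn (D1 k) t), lift (intro_vertex (D2 k) u) (dyn (D2 k) t))"
    | u where "u \<in> bag t" "s = (bag t - {u},
        lift (forget_vertex (D1 k) u) (dyn (D1 k) t), lift (forget_vertex (D2 k) u) (dyn (D2 k) t))"
    | u v where "u \<in> bag t" "v \<in> bag t" "u \<noteq> v" "s = (bag t,
        lift (intro_edge (D1 k) u v) (dyn (D1 k) t), lift (intro_edge (D2 k) u v) (dyn (D2 k) t))"
    by auto
  then show ?thesis
  proof cases
    case 1
    then have "legal k (IntroVertex u t)"
      using t by simp
    then show ?thesis
      using 1(3) C1.dyn_legal(1) C2.dyn_legal(1)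
      by (intro image_eqI[of _ _ "IntroVertex u t"]) (simp_all del: dyn.simps add: state_of_def)
  next
    case 2
    then have "legal k (ForgetVertex u t)"
      using t lab by auto
    then show ?thesis
      using 2(2) C1.dyn_legal(2) C2.dyn_legal(2)
      by (intro image_eqI[of _ _ "ForgetVertex u t"]) (simp_all del: dyn.simps add: state_of_def)
  next
    case 3
    then have "legal k (IntroEdge u v t)"
      using t lab by auto
    then show ?thesis
      using 3(4) C1.dyn_legal(3) C2.dyn_legal(3)
      by (intro image_eqI[of _ _ "IntroEdge u v t"]) (simp_all del: dyn.simps add: state_of_def)
  qed
qed

lemma join_term_state:
  assumes "r \<in> term_states" and "r' \<in> term_states" and "fst r = fst r'"
  shows "joins r r' \<in> term_states"
proof -
  obtain s t where st: "legal k s" "legal k t" "r = st s" "r' = st t"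
    using assms(1,2) by auto
  then have "legal k (Join s t)"
    using assms(3) by (simp add: fst_state_of)
  then show ?thesis
    using join_state_of[of s t] st by (intro image_eqI[of _ _ "Join s t"]) auto
qed

lemma deducible_term_state: "deducible k D1 D2 term_states s \<Longrightarrow> s \<in> term_states"
  unfolding deducible_def using init_term_state unary_term_state join_term_state by blast

lemma reachable_term_state:
  assumes "reachable k D1 D2 s"
  shows "s \<in> term_states"
proof -
  obtain ss where ss: "derivation k D1 D2 ss" "ss \<noteq> []" "last ss = s"
    using assms by (auto simp: reachable_def derives_def)
  have "set ss \<subseteq> term_states"
    using ss(1) by (rule derivation_subset[where Q = UNIV]) (auto dest: deducible_term_state)
  then show ?thesis
    using ss last_in_set by blast
qed

section \<open>Derivations through premise-satisfying states\<close>

lemma derives_unary: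
  assumes "derives k D1 D2 ss r" and "\<forall>s\<in>set ss. premise k D1 s"
    and "s \<in> unary r" and "premise k D1 s"
  shows "\<exists>ss. derives k D1 D2 ss s \<and> (\<forall>s\<in>set ss. premise k D1 s)"
proof -
  have "derivation k D1 D2 (ss @ [s])"
    using assms(1,3) last_in_set unfolding derives_def derivation_snoc_iff deducible_def by blast
  then show ?thesis
    using assms(2,4) by (intro exI[of _ "ss @ [s]"]) (auto simp: derives_def)
qed

lemma premise_if_property:
  "coherent D1 \<Longrightarrow> legal k t \<Longrightarrow> graph_of t \<in> graph_property D1 \<Longrightarrow> premise k D1 (st t)"
  by (simp add: premise_state_of graph_property_iff_accepts)

lemma property_embeds:
  "subgraph_closed (graph_property D1) \<Longrightarrow> legal k s \<Longrightarrow> embeds (graph_of s) (graph_of t) \<Longrightarrow>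
   graph_of t \<in> graph_property D1 \<Longrightarrow> graph_of s \<in> graph_property D1"
  unfolding subgraph_closed_def using is_graph_graph_of by blast

text \<open>The derivation follows the term bottom-up. Closure under subgraphs passes membership of
  the graph down to the subterms, which provides the hypothesis of the induction and hence the
  premise at every state.\<close>

lemma premise_derivation:
  assumes closed: "subgraph_closed (graph_property D1)" and coh: "coherent D1"
  shows "legal k t \<Longrightarrow> graph_of t \<in> graph_property D1 \<Longrightarrow>
    \<exists>ss. derives k D1 D2 ss (st t) \<and> (\<forall>s\<in>set ss. premise k D1 s)"
proof (induction t)
  case Leaf
  then have "premise k D1 (st Leaf)"
    using coh by (intro premise_if_property)
  then show ?case
    by (intro exI[of _ "[init]"]) (auto simp: derives_def derivation_def state_of_Leaf)
next
  case (IntroVertex u t)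
  have "graph_of t \<in> graph_property D1"
    using IntroVertex.prems by (auto intro: property_embeds[OF closed _ embeds_IntroVertex])
  then obtain ss where "derives k D1 D2 ss (st t)" "\<forall>s\<in>set ss. premise k D1 s"
    using IntroVertex by auto
  then show ?case
    using unary_state_of(1)[OF IntroVertex.prems(1)] premise_if_property[OF coh IntroVertex.prems]
    by (rule derives_unary)
next
  case (ForgetVertex u t)
  have "graph_of t \<in> graph_property D1"
    using ForgetVertex.prems by (auto intro: property_embeds[OF closed _ embeds_ForgetVertex])
  then obtain ss where "derives k D1 D2 ss (st t)" "\<forall>s\<in>set ss. premise k D1 s"
    using ForgetVertex by auto
  then show ?case
    using unary_state_of(2)[OF ForgetVertex.prems(1)] premise_if_property[OF coh ForgetVertex.prems]
    by (rule derives_unary)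
next
  case (IntroEdge u v t)
  have "graph_of t \<in> graph_property D1"
    using IntroEdge.prems by (auto intro: property_embeds[OF closed _ embeds_IntroEdge[OF IntroEdge.prems(1)]])
  then obtain ss where "derives k D1 D2 ss (st t)" "\<forall>s\<in>set ss. premise k D1 s"
    using IntroEdge by auto
  then show ?case
    using unary_state_of(3)[OF IntroEdge.prems(1)] premise_if_property[OF coh IntroEdge.prems]
    by (rule derives_unary)
next
  case (Join s t)
  have "graph_of s \<in> graph_property D1" "graph_of t \<in> graph_property D1"
    using Join.prems property_embeds[OF closed _ embeds_Join(1)[OF Join.prems(1)]]
      property_embeds[OF closed _ embeds_Join(2)[OF Join.prems(1)]] by auto
  then obtain ss ss' where ss: "derives k D1 D2 ss (st s)" "\<forall>r\<in>set ss. premise k D1 r"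
    and ss': "derives k D1 D2 ss' (st t)" "\<forall>r\<in>set ss'. premise k D1 r"
    using Join by auto
  \<comment> \<open>The two derivations are concatenated; each ends in the state of one child, so
    both are available to the join rule.\<close>
  then have last: "st s \<in> set ss" "st t \<in> set ss'"
    unfolding derives_def using last_in_set by metis+
  have "fst (st s) = fst (st t)" "st (Join s t) = joins (st s) (st t)"
    using Join.prems join_state_of by (simp_all add: fst_state_of)
  with last have "deducible k D1 D2 (set (ss @ ss')) (st (Join s t))"
    unfolding deducible_def by auto
  moreover have "derivation k D1 D2 (ss @ ss')"
    using ss(1) ss'(1) by (simp add: derives_def derivation_append)
  ultimately have "derivation k D1 D2 ((ss @ ss') @ [st (Join s t)])"
    by (simp only: derivation_snoc_iff)
  moreover have "premise k D1 (st (Join s t))"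
    using coh Join.prems by (rule premise_if_property)
  ultimately show ?case
    using ss(2) ss'(2)
    by (intro exI[of _ "(ss @ ss') @ [st (Join s t)]"]) (auto simp: derives_def)
qed

section \<open>The test\<close>

text \<open>The states of \<open>R\<close> have been processed, and \<open>S\<close> contains the successors this produced.\<close>

definition saturated :: "state set \<Rightarrow> state set \<Rightarrow> bool" where
  "saturated R S \<longleftrightarrow> init \<in> S \<and> S \<subseteq> term_states \<and>
     (\<forall>r\<in>R. \<not> inconsistent k D1 D2 r) \<and>
     (\<forall>r\<in>R. premise k D1 r \<longrightarrow> unary r \<subseteq> S) \<and>
     (\<forall>r\<in>R. \<forall>r'\<in>R. premise k D1 r \<longrightarrow> premise k D1 r' \<longrightarrow> fst r = fst r' \<longrightarrow> joins r r' \<in> S)"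

text \<open>Distinctness of \<open>R @ Y\<close> bounds the number of iterations. When the queue is
  empty, \<open>R\<close> and \<open>Seen\<close> agree as sets, so \<open>Seen\<close> is saturated
  with respect to itself; this is the certificate kept for the outcome
  \<open>Inclusion_Holds\<close>.\<close>

fun invariant :: "config \<Rightarrow> bool" where
  "invariant (Running R Y Seen) \<longleftrightarrow>
     distinct (R @ Y) \<and> set (R @ Y) = Seen \<and> saturated (set R) Seen"
| "invariant (Returned (Found R)) \<longleftrightarrow> (\<exists>s\<in>term_states. inconsistent k D1 D2 s)"
| "invariant (Returned Inclusion_Holds) \<longleftrightarrow> (\<exists>S. saturated S S)"

text \<open>Each insertion updates \<open>Seen\<close> at once, so repetitions within
  \<open>ss\<close> are skipped and the result is independent of the enumeration up to the order of
  \<open>Z\<close>.\<close>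

lemma fold_enqueue:
  "fold enqueue ss (Y, Seen) = (Y', Seen') \<Longrightarrow>
   \<exists>Z. Y' = Y @ Z \<and> distinct Z \<and> set Z = set ss - Seen \<and> Seen' = Seen \<union> set ss"
proof (induction ss arbitrary: Y Seen)
  case (Cons s ss)
  show ?case
  proof (cases "s \<in> Seen")
    case True
    then show ?thesis
      using Cons.IH[of Y Seen] Cons.prems by (auto simp: enqueue_def)
  next
    case False
    then obtain Z where "Y' = (Y @ [s]) @ Z" "distinct Z" "set Z = set ss - insert s Seen"
      "Seen' = insert s Seen \<union> set ss"
      using Cons.IH[of "Y @ [s]" "insert s Seen"] Cons.prems by (auto simp: enqueue_def)
    then show ?thesis
      using False by (intro exI[of _ "s # Z"]) auto
  qed
qed simp

lemma successors_term_states: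
  assumes "set R \<subseteq> term_states" and "t \<in> term_states"
  shows "successors k D1 D2 R t \<subseteq> term_states"
proof
  fix s assume "s \<in> successors k D1 D2 R t"
  then consider "s \<in> unary t"
    | r where "r \<in> set R" "fst r = fst t" "s = joins t r"
    | r where "r \<in> set R" "fst r = fst t" "s = joins r t"
    by (auto simp: successors_def)
  then show "s \<in> term_states"
  proof cases
    case 1
    then show ?thesis
      using assms(2) unary_term_state by blast
  next
    case (2 r)
    then show ?thesis
      using join_term_state[of t r] assms by auto
  next
    case (3 r)
    then show ?thesis
      using join_term_state[of r t] assms by auto
  qed
qed

lemma step_invariant:
  assumes "step k D1 D2 c c'" and "invariant c"
  shows "invariant c'"
  using assms
proof cases
  case (step_empty R Seen)
  then show ?thesis
    using assms(2) by auto
next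
  case (step_inconsistent t R Y Seen)
  then have "t \<in> term_states"
    using assms(2) by (auto simp: saturated_def)
  then show ?thesis
    using step_inconsistent(2,3) by (simp only: invariant.simps) blast
next
  case (step_prune t R Y Seen)
  then have old: "distinct (R @ t # Y)" "set (R @ t # Y) = Seen" "saturated (set R) Seen"
    using assms(2) by simp_all
  \<comment> \<open>A pruned state adds no closure obligation, since those in
    \<open>saturated\<close> concern only states satisfying the premise.\<close>
  then have "saturated (insert t (set R)) Seen"
    using step_prune(3,4) by (simp add: saturated_def del: inconsistent.simps)
  then show ?thesis
    using old step_prune(2) by auto
next
  case (step_expand t ss R Y Seen Y' Seen')
  have old: "distinct (R @ t # Y)" "set (R @ t # Y) = Seen" "saturated (set R) Seen"
    using assms(2) step_expand(1) by simp_all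
  obtain Z where Z: "Y' = Y @ Z" "distinct Z" "set Z = set ss - Seen" "Seen' = Seen \<union> set ss"
    using fold_enqueue step_expand(6) by blast
  have "Seen \<subseteq> term_states"
    using old(3) by (simp add: saturated_def)
  then have "set ss \<subseteq> term_states"
    using old(2) step_expand(5) successors_term_states[of "R @ [t]" t] by auto
  moreover have "unary t \<subseteq> set ss"
    using step_expand(5) by (auto simp: successors_def)
  \<comment> \<open>\<open>t\<close> is already in the processed list, so its join with itself is
    covered. Both orders are required, as joining need not be symmetric.\<close>
  moreover have "joins t r \<in> set ss" "joins r t \<in> set ss"
    if "r \<in> insert t (set R)" "premise k D1 r" "fst r = fst t" for r
  proof -
    have "r \<in> {s \<in> set (R @ [t]). fst s = fst t \<and> premise k D1 s}"
      using that by simp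
    then show "joins t r \<in> set ss" "joins r t \<in> set ss"
      unfolding step_expand(5) successors_def by blast+
  qed
  ultimately have "saturated (insert t (set R)) Seen'"
    using old(3) step_expand(3) Z(4) unfolding saturated_def
    by (simp del: inconsistent.simps) blast
  then show ?thesis
    using old Z step_expand(2) by auto
qed

lemma reaches_invariant: "test_reaches k D1 D2 c \<Longrightarrow> invariant c"
  unfolding test_reaches_def
proof (induction rule: rtranclp_induct)
  case base
  show ?case
    using init_term_state by (simp add: init_config_def saturated_def)
qed (rule step_invariant)

section \<open>Termination\<close>

lemma running_length_bound:
  assumes "invariant (Running R Y Seen)"
  shows "length R \<le> card (states k D1 D2)"
proof -
  have "set R \<subseteq> term_states"
    using assms by (auto simp: saturated_def)
  also have "\<dots> \<subseteq> states k D1 D2"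
    using state_of_in_states by blast
  finally have "card (set R) \<le> card (states k D1 D2)"
    using finite_states by (intro card_mono)
  then show ?thesis
    using assms by (simp add: distinct_card)
qed

text \<open>Only expansion could get stuck, for lack of a list enumerating the successors. They are
  states of legal terms, hence finitely many.\<close>

lemma step_exists:
  assumes "invariant (Running R Y Seen)"
  shows "\<exists>c. step k D1 D2 (Running R Y Seen) c"
proof (cases Y)
  case Nil
  then show ?thesis
    using step_empty by blast
next
  case (Cons t Y')
  show ?thesis
  proof (cases "inconsistent k D1 D2 t \<or> \<not> premise k D1 t")
    case True
    then show ?thesis
      using step_inconsistent step_prune unfolding Cons by blast
  next
    case False
    have "successors k D1 D2 (R @ [t]) t \<subseteq> term_states"
      using assms Cons by (intro successors_term_states) (auto simp: saturated_def)
    also have "\<dots> \<subseteq> states k D1 D2"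
      using state_of_in_states by auto
    finally obtain ss where ss: "set ss = successors k D1 D2 (R @ [t]) t"
      using finite_states finite_list finite_subset by metis
    obtain Y'' Seen'' where "fold enqueue ss (Y', Seen) = (Y'', Seen'')"
      by (cases "fold enqueue ss (Y', Seen)")
    then show ?thesis
      using False ss step_expand unfolding Cons by blast
  qed
qed

lemma terminates: "test_terminates k D1 D2"
  unfolding test_terminates_def
proof (intro conjI allI impI notI)
  assume "\<exists>c. c 0 = init_config k D1 D2 \<and> (\<forall>i::nat. step k D1 D2 (c i) (c (Suc i)))"
  then obtain c where c0: "c 0 = init_config k D1 D2"
    and step: "\<And>i::nat. step k D1 D2 (c i) (c (Suc i))"
    by blast
  have "test_reaches k D1 D2 (c i)" for i
    unfolding test_reaches_def
    by (induction i) (use c0 step in \<open>auto intro: rtranclp.rtrancl_into_rtrancl\<close>)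
  then have inv: "invariant (c i)" for i
    by (rule reaches_invariant)
  \<comment> \<open>Every iteration that does not return appends one state to \<open>R\<close>, so
    the length of \<open>R\<close> counts the steps.\<close>
  have "\<exists>R Y Seen. c i = Running R Y Seen \<and> length R = i" for i
  proof (induction i)
    case 0
    show ?case
      by (simp add: c0 init_config_def)
  next
    case (Suc i)
    then obtain R Y Seen where R: "c i = Running R Y Seen" "length R = i"
      by blast
    \<comment> \<open>A configuration with a successor has not returned, which leaves only pruning
      and expansion for the step before it.\<close>
    have "\<exists>c''. step k D1 D2 (c (Suc i)) c''"
      using step by blast
    with step[of i] R show ?case
      by (auto elim!: step.cases)
  qed
  then obtain R Y Seen where "c (Suc (card (states k D1 D2))) = Running R Y Seen"
    "length R = Suc (card (states k D1 D2))"
    by blast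
  then show False
    using running_length_bound inv by (metis Suc_n_not_le_n)
next
  fix c assume "test_reaches k D1 D2 c" and "\<nexists>c'. step k D1 D2 c c'"
  then show "\<exists>r. c = Returned r"
    using reaches_invariant step_exists by (cases c) blast+
qed

section \<open>Correctness of the outcomes\<close>

text \<open>A saturated set absorbs every derivation whose intermediate states satisfy the premise,
  and it contains no inconsistent state. Hence pruned search misses no target of such a
  derivation.\<close>

lemma saturated_consistent:
  assumes "saturated S S" and "derives k D1 D2 ss s" and "\<forall>s'\<in>set (butlast ss). premise k D1 s'"
  shows "\<not> inconsistent k D1 D2 s"
proof -
  have ss: "derivation k D1 D2 ss" "ss \<noteq> []" "last ss = s"
    using assms(2) by (auto simp: derives_def)
  have "set ss \<subseteq> S"
    using ss(1)
  proof (rule derivation_subset)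
    show "set (butlast ss) \<subseteq> {s. premise k D1 s}"
      using assms(3) by auto
    fix s assume "deducible k D1 D2 (S \<inter> {s. premise k D1 s}) s"
    then show "s \<in> S"
      using assms(1) unfolding deducible_def saturated_def
      by (elim disjE bexE conjE) auto
  qed
  then show ?thesis
    using assms(1) ss last_in_set unfolding saturated_def by blast
qed

end

theorem theorem5:
  fixes k :: nat and D1 D2 :: dp_core and P1 P2 :: "graph set"
  assumes "is_dp_core D1" and "finite_core D1" and "coherent D1" and "identity_cleaning D1"
    and "is_dp_core D2" and "finite_core D2" and "coherent D2" and "identity_cleaning D2"
    and "P1 = graph_property D1" and "P2 = graph_property D2"
    and "subgraph_closed P1"
  shows "test_terminates k D1 D2 \<and>
    ((\<exists>s\<in>states k D1 D2. reachable k D1 D2 s \<and> inconsistent k D1 D2 s) \<longrightarrow>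
       (\<exists>t\<in>terms k. graph_of t \<in> P1 \<and> graph_of t \<notin> P2)) \<and>
    ((\<exists>t\<in>terms k. graph_of t \<in> P1 \<and> graph_of t \<notin> P2) \<longrightarrow>
       (\<exists>s\<in>states k D1 D2. inconsistent k D1 D2 s \<and>
          (\<exists>ss. derives k D1 D2 ss s \<and> (\<forall>s'\<in>set (butlast ss). premise k D1 s')))) \<and>
    (\<forall>r. test_returns k D1 D2 r \<longrightarrow>
       (r = Inclusion_Holds \<longleftrightarrow> \<not> (\<exists>t\<in>terms k. graph_of t \<in> P1 \<and> graph_of t \<notin> P2)))"
proof -
  interpret core_pair k D1 D2
    using assms by unfold_locales
  let ?cex = "\<exists>t\<in>terms k. graph_of t \<in> P1 \<and> graph_of t \<notin> P2"
  have cex: "graph_of t \<in> P1 \<and> graph_of t \<notin> P2 \<longleftrightarrow> inconsistent k D1 D2 (st t)" if "legal k t" for t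
    using that assms graph_property_iff_accepts by (simp add: inconsistent_state_of)
  \<comment> \<open>Stated for states of terms, this serves both reachable inconsistent states and
    the outcome \<open>Found\<close>.\<close>
  have sound: ?cex if "s \<in> term_states" "inconsistent k D1 D2 s" for s
    using that cex by (auto simp: terms_def)
  have complete: "\<exists>s\<in>states k D1 D2. inconsistent k D1 D2 s \<and>
      (\<exists>ss. derives k D1 D2 ss s \<and> (\<forall>s'\<in>set (butlast ss). premise k D1 s'))" if c: ?cex
  proof -
    obtain t where t: "legal k t" "graph_of t \<in> P1" "graph_of t \<notin> P2"
      using c by (auto simp: terms_def)
    obtain ss where "derives k D1 D2 ss (st t)" "\<forall>s\<in>set ss. premise k D1 s"
      using premise_derivation t assms by metis
    then show ?thesis
      using t cex state_of_in_states in_set_butlastD by metis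
  qed
  have result: "r = Inclusion_Holds \<longleftrightarrow> \<not> ?cex" if "test_returns k D1 D2 r" for r
  proof -
    have inv: "invariant (Returned r)"
      using that reaches_invariant by (simp add: test_returns_def)
    show ?thesis
    proof (cases r)
      case (Found R)
      then have "\<exists>s\<in>term_states. inconsistent k D1 D2 s"
        using inv by (simp only: invariant.simps)
      then have ?cex
        using sound by (elim bexE)
      then show ?thesis
        using Found by blast
    next
      case Inclusion_Holds
      then obtain S where "saturated S S"
        using inv by auto
      \<comment> \<open>A counterexample would have a derivation through premise-satisfying states
        to an inconsistent state, which the saturated set excludes.\<close>
      then have "\<not> ?cex"
        using complete saturated_consistent by metis
      then show ?thesis
        using Inclusion_Holds by blast
    qed
  qed
  show ?thesis
  proof (intro conjI impI allI)
    assume "\<exists>s\<in>states k D1 D2. reachable k D1 D2 s \<and> inconsistent k D1 D2 s"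
    then show ?cex
      by (elim bexE conjE) (rule sound[OF reachable_term_state])
  qed (fact terminates complete result)+
qed

end
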